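(* Let $T$ be a finite tree on at least two vertices. Then the girth of the eccentric graph $E(T)$ is either $0$, $3$ or $4$. Moreover, the girth of $E(T)$ equals - $3$ if the diameter of $T$ is even; - $0$ if the diameter of $T$ is odd and $T$ has a unique diametrical path; - $4$ otherwise.
   Context: For a connected simple graph $G$, $d_G$ is the graph distance and $e_G(v)=\max\{d_G(u,v):u\in V(G)\}$. A vertex $u$ is eccentric to $v$ if $d_G(u,v)=e_G(v)$. The eccentric graph $E(G)$ is the simple graph on vertex set $V(G)$ in which two distinct vertices $u,v$ are adjacent iff $u$ is eccentric to $v$ or $v$ is eccentric to $u$. The girth of a graph is the length of its shortest cycle, with the convention that a graph with no cycles has girth $0$. A diametrical path in a tree $T$ is a path of length $\mathrm{diam}(T)$, i.e. a longest path; a path and its reversal are regarded as the same path. *)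

theory Defs
  imports "Graph_Theory.Graph_Theory"
begin

text \<open>
  A finite simple graph is a \<^locale>\<open>pair_graph\<close>: every edge \<open>uv\<close> is represented by the two
  arcs \<open>(u, v)\<close> and \<open>(v, u)\<close>. Walks, paths and cycles are lists of arcs, so \<^const>\<open>length\<close> is the
  number of edges.
\<close>

text \<open>
  \<^const>\<open>pre_digraph.cycle\<close> also admits the closed walk \<open>u, v, u\<close> along a single edge. It has length 2
  and is not a cycle of the underlying simple graph. For the same reason \<^const>\<open>tree\<close> is of no use
  here: it holds for no \<^locale>\<open>pair_graph\<close> with an edge.
\<close>

definition simple_cycle :: "'a pair_pre_digraph \<Rightarrow> ('a \<times> 'a) awalk \<Rightarrow> bool" where
  "simple_cycle G p \<longleftrightarrow> pre_digraph.cycle G p \<and> 3 \<le> length p"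

definition simple_tree :: "'a pair_pre_digraph \<Rightarrow> bool" where
  "simple_tree G \<longleftrightarrow> pair_graph G \<and> connected G \<and> \<not> (\<exists>p. simple_cycle G p)"

definition girth :: "'a pair_pre_digraph \<Rightarrow> nat" where
  "girth G = (if \<exists>p. simple_cycle G p then LEAST n. \<exists>p. simple_cycle G p \<and> length p = n else 0)"

text \<open>Only meaningful if some walk joins \<open>u\<close> and \<open>v\<close>, in particular in connected graphs.\<close>

definition graph_dist :: "'a pair_pre_digraph \<Rightarrow> 'a \<Rightarrow> 'a \<Rightarrow> nat" where
  "graph_dist G u v = (LEAST n. \<exists>p. pre_digraph.awalk G u p v \<and> length p = n)"

definition eccentricity :: "'a pair_pre_digraph \<Rightarrow> 'a \<Rightarrow> nat" where
  "eccentricity G v = Max {graph_dist G u v | u. u \<in> pverts G}"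

definition diam :: "'a pair_pre_digraph \<Rightarrow> nat" where
  "diam G = Max {graph_dist G u v | u v. u \<in> pverts G \<and> v \<in> pverts G}"

definition eccentric_to :: "'a pair_pre_digraph \<Rightarrow> 'a \<Rightarrow> 'a \<Rightarrow> bool" where
  "eccentric_to G u v \<longleftrightarrow> graph_dist G u v = eccentricity G v"

definition eccentric_graph :: "'a pair_pre_digraph \<Rightarrow> 'a pair_pre_digraph" where
  "eccentric_graph G =
    \<lparr> pverts = pverts G,
      parcs = {(u, v). u \<in> pverts G \<and> v \<in> pverts G \<and> u \<noteq> v \<and>
                       (eccentric_to G u v \<or> eccentric_to G v u)} \<rparr>"

definition diametrical_path :: "'a pair_pre_digraph \<Rightarrow> ('a \<times> 'a) awalk \<Rightarrow> bool" where
  "diametrical_path G p \<longleftrightarrow> (\<exists>u v. pre_digraph.apath G u p v) \<and> length p = diam G"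

text \<open>\<^const>\<open>rev_path\<close> traverses a path backwards; a path and its reversal are the same path.\<close>

definition unique_diametrical_path :: "'a pair_pre_digraph \<Rightarrow> bool" where
  "unique_diametrical_path G \<longleftrightarrow>
    (\<exists>p. diametrical_path G p \<and> (\<forall>q. diametrical_path G q \<longrightarrow> q = p \<or> q = rev_path p))"

lemma pair_graph_eccentric_graph:
  assumes "pair_graph G"
  shows "pair_graph (eccentric_graph G)"
proof -
  interpret pair_graph G by fact
  have "finite (parcs (eccentric_graph G))"
    by (rule finite_subset[of _ "pverts G \<times> pverts G"])
      (auto simp: eccentric_graph_def pair_finite_verts)
  then show ?thesis
    by unfold_locales
      (auto simp: eccentric_graph_def pair_finite_verts symmetric_def intro!: symI)
qed

end

theory Submission
  imports Defs
begin

text \<open>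
  Everything rests on one property of an edge \<open>ab\<close> of a tree: removing it splits the vertices into
  two sides, and \<open>d(x, y) = d(x, a) + 1 + d(b, y)\<close> for \<open>x\<close> on the side of \<open>a\<close> and \<open>y\<close> on the side of
  \<open>b\<close>. If the diameter is \<open>2r\<close>, this shows that the midpoint \<open>c\<close> of a diametrical path has all
  vertices within distance \<open>r\<close>, so \<open>c\<close> and the two ends of the path form a triangle in \<open>E(T)\<close>. If the
  diameter is \<open>2r + 1\<close>, let \<open>ab\<close> be the middle edge of a diametrical path and call a vertex extremal
  if it has distance \<open>r\<close> from the end of \<open>ab\<close> on its own side. Then \<open>E(T)\<close> is bipartite, and \<open>x\<close>, \<open>y\<close> on
  opposite sides are adjacent iff one of them is extremal. With just one extremal vertex on each side
  this is a double star, and otherwise it contains a 4-cycle. The former happens exactly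
  when the diametrical path is unique.
\<close>

section \<open>Short cycles and girth\<close>

lemma pcas_nth_Suc:
  assumes "pcas u p v" "Suc i < length p"
  shows "snd (p ! i) = fst (p ! Suc i)"
  using assms
proof (induction u p v arbitrary: i rule: pcas.induct)
  case (2 u e es v)
  then show ?case by (cases i; cases es) auto
qed simp

lemma pcas_hd_last:
  assumes "pcas u p v" "p \<noteq> []"
  shows "fst (hd p) = u" "snd (last p) = v"
  using assms by (induction u p v rule: pcas.induct) (auto split: if_splits)

text \<open>On a closed nonempty walk, the visited vertices after the first are exactly the heads of
  the arcs. So cycles can be handled through \<open>map snd p\<close> alone, without
  \<open>awalk_verts\<close>, and the first arc already puts the base point into
  \<open>pverts G\<close>.\<close>

lemma simple_cycle_conv:
  fixes G :: "'a pair_pre_digraph"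
  assumes "pair_graph G"
  shows "simple_cycle G p \<longleftrightarrow>
    3 \<le> length p \<and> set p \<subseteq> parcs G \<and> distinct (map snd p) \<and> (\<exists>u. pcas u p u)"
proof -
  interpret pair_graph G by fact
  have "distinct (tl (awalk_verts u p)) \<longleftrightarrow> distinct (map snd p)" if "pcas u p u" "p \<noteq> []" for u
  proof -
    have "awalk_verts u p = fst (hd p) # map snd p"
      using awalk_verts_conv'[of u p u] that by simp
    then show ?thesis by simp
  qed
  moreover have "u \<in> pverts G" if "pcas u p u" "p \<noteq> []" "set p \<subseteq> parcs G" for u
    using pcas_hd_last(1)[OF that(1,2)] that(2,3) arc_fst_in_verts by (metis hd_in_set subsetD)
  ultimately show ?thesis
    unfolding simple_cycle_def cycle_def awalk_def by fastforce
qed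

lemma girth_eqI:
  assumes "simple_cycle G p" "\<And>q. simple_cycle G q \<Longrightarrow> length p \<le> length q"
  shows "girth G = length p"
proof -
  have "(LEAST n. \<exists>q. simple_cycle G q \<and> length q = n) = length p"
    using assms by (intro Least_equality) auto
  with assms(1) show ?thesis unfolding girth_def by auto
qed

lemma girth_triangle:
  assumes "pair_graph G" "(x, y) \<in> parcs G" "(y, z) \<in> parcs G" "(z, x) \<in> parcs G"
  shows "girth G = 3"
proof -
  interpret pair_graph G by fact
  have "simple_cycle G [(x, y), (y, z), (z, x)]"
    unfolding simple_cycle_conv[OF assms(1)] using assms no_loops' by auto
  from girth_eqI[OF this] show ?thesis by (simp add: simple_cycle_def)
qed

lemma girth_square:
  assumes "pair_graph G" "(x, y) \<in> parcs G" "(y, z) \<in> parcs G" "(z, w) \<in> parcs G" "(w, x) \<in> parcs G"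
    and "x \<noteq> z" "y \<noteq> w"
    and no_triangle: "\<And>a b c. (a, b) \<in> parcs G \<Longrightarrow> (b, c) \<in> parcs G \<Longrightarrow> (c, a) \<notin> parcs G"
  shows "girth G = 4"
proof -
  interpret pair_graph G by fact
  have cyc: "simple_cycle G [(x, y), (y, z), (z, w), (w, x)]"
    unfolding simple_cycle_conv[OF assms(1)] using assms(2-7) no_loops' by auto
  have "length q \<noteq> 3" if "simple_cycle G q" for q
  proof
    assume "length q = 3"
    then obtain e f g where "q = [e, f, g]"
      by (auto simp: numeral_3_eq_3 length_Suc_conv)
    with that show False
      using no_triangle[of "fst e" "snd e" "snd f"]
      by (cases e; cases f; cases g) (auto simp: simple_cycle_conv[OF assms(1)])
  qed
  then have "4 \<le> length q" if "simple_cycle G q" for q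
    using that by (fastforce simp: simple_cycle_def)
  with girth_eqI[OF cyc] show ?thesis by fastforce
qed

text \<open>A cycle has at least three distinct vertices, so it visits some vertex other than
  \<open>u\<close> and \<open>v\<close>. Its predecessor and successor on the cycle are two
  different neighbours, which \<open>leaf\<close> forbids.\<close>

lemma girth_double_star:
  assumes "pair_graph G"
    and leaf: "\<And>x y z. x \<noteq> u \<Longrightarrow> x \<noteq> v \<Longrightarrow> (x, y) \<in> parcs G \<Longrightarrow> (x, z) \<in> parcs G \<Longrightarrow> y = z"
  shows "girth G = 0"
proof -
  interpret pair_graph G by fact
  have False if "simple_cycle G p" for p
  proof -
    define n where "n = length p"
    from that obtain w where p: "3 \<le> n" "set p \<subseteq> parcs G" "distinct (map snd p)" "pcas w p w"
      unfolding simple_cycle_conv[OF assms(1)] n_def by blast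
    have "\<not> set (map snd p) \<subseteq> {u, v}"
    proof
      assume "set (map snd p) \<subseteq> {u, v}"
      then have "card (set (map snd p)) \<le> card {u, v}" by (intro card_mono) auto
      also have "\<dots> \<le> 2" by (simp add: card_insert_if)
      finally show False using p(1,3) distinct_card[OF p(3)] by (simp add: n_def)
    qed
    then obtain x where "x \<in> set (map snd p)" "x \<noteq> u" "x \<noteq> v" by blast
    then obtain i where i: "i < n" "snd (p ! i) \<noteq> u" "snd (p ! i) \<noteq> v"
      unfolding in_set_conv_nth n_def by auto
    \<comment> \<open>Indices are cyclic: the walk is closed, so the head of the last arc is the
      tail of arc 0.\<close>
    define next_index where "next_index j = (if Suc j = n then 0 else Suc j)" for j
    have step: "snd (p ! j) = fst (p ! next_index j)" "next_index j < n" if "j < n" for j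
    proof -
      have "p \<noteq> []" using p(1) by (auto simp: n_def)
      then show "snd (p ! j) = fst (p ! next_index j)"
        using pcas_nth_Suc[OF p(4), of j] pcas_hd_last[OF p(4)] that
        by (auto simp: next_index_def n_def hd_conv_nth last_conv_nth dest: arg_cong[of _ _ "\<lambda>m. m - 1"])
      show "next_index j < n" using that p(1) by (auto simp: next_index_def)
    qed
    \<comment> \<open>The cyclic predecessor of \<open>i\<close>. It differs from the successor
      because \<open>n\<close> is at least 3.\<close>
    define k where "k = (if i = 0 then n - 1 else i - 1)"
    have k: "k < n" "next_index k = i" "next_index i \<noteq> k"
      using i p(1) by (auto simp: k_def next_index_def)
    have "(snd (p ! i), snd (p ! next_index i)) \<in> parcs G"
      using step[OF i(1)] p(2) nth_mem[of "next_index i" p] by (auto simp: n_def)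
    moreover have "p ! i \<in> parcs G" using p(2) nth_mem[of i p] i(1) by (auto simp: n_def)
    then have "(snd (p ! i), snd (p ! k)) \<in> parcs G"
      using step(1)[OF k(1)] k(2) arcs_symmetric[of "fst (p ! i)" "snd (p ! i)"] by simp
    ultimately have "snd (p ! next_index i) = snd (p ! k)"
      using leaf i by blast
    then have "next_index i = k"
      using p(3) step(2)[OF i(1)] k(1) nth_eq_iff_index_eq[of "map snd p" "next_index i" k]
      by (simp add: n_def)
    with k show False by simp
  qed
  then show ?thesis unfolding girth_def by auto
qed

section \<open>Distances in connected graphs\<close>

lemma length_rev_path: "length (rev_path p) = length p"
  by (induction p) auto

locale connected_pair_graph = pair_graph G for G :: "'a pair_pre_digraph" +
  assumes connected: "connected G"
begin

abbreviation dist :: "'a \<Rightarrow> 'a \<Rightarrow> nat" where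
  "dist \<equiv> graph_dist G"

lemma graph_dist_le_length: "awalk u p v \<Longrightarrow> dist u v \<le> length p"
  unfolding graph_dist_def by (rule Least_le) auto

lemma shortest_awalk:
  assumes "u \<in> pverts G" "v \<in> pverts G"
  obtains p where "awalk u p v" "length p = dist u v"
proof -
  \<comment> \<open>\<open>connected\<close> means strong connectivity of the symmetric closure,
    which here adds no arcs.\<close>
  have "mk_symmetric (with_proj G) = G"
    using arcs_symmetric by (auto simp: mk_symmetric_def intro!: pair_pre_digraph.equality)
  then have "u \<rightarrow>\<^sup>*\<^bsub>G\<^esub> v"
    using connected assms by (auto simp: connected_def strongly_connected_def)
  then obtain p where "awalk u p v" using reachable_awalk by blast
  then have "\<exists>n p. awalk u p v \<and> length p = n" by blast
  from LeastI_ex[OF this] that show thesis unfolding graph_dist_def by blast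
qed

lemma shortest_apath:
  assumes "u \<in> pverts G" "v \<in> pverts G"
  obtains p where "apath u p v" "length p = dist u v"
proof -
  obtain p where p: "awalk u p v" "length p = dist u v"
    using shortest_awalk[OF assms] .
  have "distinct (awalk_verts u p)"
  proof (rule ccontr)
    assume "\<not> distinct (awalk_verts u p)"
    with p(1) obtain q r s where "p = q @ r @ s" "\<exists>w. awalk u q w \<and> awalk w r w \<and> awalk w s v"
      and "closed_w r"
      by (rule awalk_cyc_decompE')
    then have "awalk u (q @ s) v" "length (q @ s) < length p"
      by (auto simp: closed_w_def)
    with graph_dist_le_length[of u "q @ s" v] p(2) show False by simp
  qed
  with p that show thesis by (auto simp: apath_def)
qed

lemma graph_dist_self: "u \<in> pverts G \<Longrightarrow> dist u u = 0"
  using graph_dist_le_length[of u "[]" u] by (simp add: awalk_Nil_iff)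

lemma graph_dist_eq_0D:
  assumes "u \<in> pverts G" "v \<in> pverts G" "dist u v = 0"
  shows "u = v"
  using shortest_awalk[OF assms(1,2)] assms(3) awalk_Nil_iff by (metis length_0_conv)

lemma graph_dist_arc: "(u, v) \<in> parcs G \<Longrightarrow> dist u v \<le> 1"
  using graph_dist_le_length[of u "[(u, v)]" v] by (auto simp: awalk_simps dest: wellformed')

lemma graph_dist_triangle:
  assumes "u \<in> pverts G" "v \<in> pverts G" "w \<in> pverts G"
  shows "dist u w \<le> dist u v + dist v w"
proof -
  obtain p q where "awalk u p v" "length p = dist u v" "awalk v q w" "length q = dist v w"
    using shortest_awalk assms by metis
  then show ?thesis using graph_dist_le_length[of u "p @ q" w] awalk_appendI by auto
qed

lemma graph_dist_commute:
  assumes "u \<in> pverts G" "v \<in> pverts G"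
  shows "dist u v = dist v u"
proof (rule antisym)
  have "dist y x \<le> dist x y" if xy: "x \<in> pverts G" "y \<in> pverts G" for x y
  proof -
    obtain p where "awalk x p y" "length p = dist x y" using shortest_awalk[OF xy] .
    then show ?thesis using graph_dist_le_length[of y "rev_path p" x] by (simp add: length_rev_path)
  qed
  with assms show "dist u v \<le> dist v u" "dist v u \<le> dist u v" by blast+
qed

text \<open>Cutting a shortest walk after \<open>m\<close> arcs bounds the two distances by
  \<open>m\<close> and \<open>n\<close>; the triangle inequality turns both bounds into
  equalities.\<close>

lemma graph_dist_splitE:
  assumes "u \<in> pverts G" "v \<in> pverts G" "dist u v = m + n"
  obtains c where "c \<in> pverts G" "dist u c = m" "dist c v = n"
proof -
  obtain p where p: "awalk u p v" "length p = m + n"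
    using shortest_awalk[OF assms(1,2)] assms(3) by metis
  define c where "c = awlast u (take m p)"
  have "awalk u (take m p @ drop m p) v" using p(1) by simp
  then have walks: "awalk u (take m p) c" "awalk c (drop m p) v"
    unfolding awalk_append_iff c_def by auto
  then have c: "c \<in> pverts G" using awalk_hd_in_verts by blast
  have "dist u c \<le> m" "dist c v \<le> n"
    using graph_dist_le_length[OF walks(1)] graph_dist_le_length[OF walks(2)] p(2) by auto
  with graph_dist_triangle[OF assms(1) c assms(2)] assms(3) c that show thesis by force
qed

lemma graph_dist_Suc_arcE:
  assumes "u \<in> pverts G" "v \<in> pverts G" "dist u v = Suc n"
  obtains w where "(u, w) \<in> parcs G" "dist w v = n"
proof -
  obtain p where p: "awalk u p v" "length p = Suc n"
    using shortest_awalk[OF assms(1,2)] assms(3) by metis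
  then obtain e q where "p = e # q" by (cases p) auto
  with p have e: "(u, snd e) \<in> parcs G" "awalk (snd e) q v" "length q = n"
    by (auto simp: awalk_Cons_iff)
  then have "dist (snd e) v \<le> n" using graph_dist_le_length by blast
  moreover have "dist u v \<le> 1 + dist (snd e) v"
    using graph_dist_triangle[of u "snd e" v] graph_dist_arc[OF e(1)] assms in_arcsD2[OF e(1)]
    by simp
  ultimately show thesis using that[OF e(1)] assms(3) by simp
qed

section \<open>Diameter and eccentricity as maxima of finite sets\<close>

lemma finite_dists: "finite {dist u v | u v. u \<in> pverts G \<and> v \<in> pverts G}"
  by (rule finite_subset[of _ "(\<lambda>(u, v). dist u v) ` (pverts G \<times> pverts G)"])
    (auto simp: pair_finite_verts)

lemma graph_dist_le_diam: "u \<in> pverts G \<Longrightarrow> v \<in> pverts G \<Longrightarrow> dist u v \<le> diam G"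
  unfolding diam_def using finite_dists by (intro Max_ge) auto

lemma diam_attained:
  obtains u v where "u \<in> pverts G" "v \<in> pverts G" "dist u v = diam G"
proof -
  have "pverts G \<noteq> {}" using connected by (auto simp: connected_def strongly_connected_def)
  then have "{dist u v | u v. u \<in> pverts G \<and> v \<in> pverts G} \<noteq> {}" by blast
  from Max_in[OF finite_dists this] that show thesis unfolding diam_def by auto
qed

lemma eccentric_to_iff:
  assumes "u \<in> pverts G"
  shows "eccentric_to G u v \<longleftrightarrow> (\<forall>w\<in>pverts G. dist w v \<le> dist u v)"
proof -
  let ?D = "{dist w v | w. w \<in> pverts G}"
  have "finite ?D" by (simp add: pair_finite_verts)
  moreover have "?D \<noteq> {}" "dist u v \<in> ?D" using assms by auto
  ultimately show ?thesis
    using \<open>dist u v \<in> ?D\<close>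
    unfolding eccentric_to_def eccentricity_def eq_Max_iff[OF \<open>finite ?D\<close> \<open>?D \<noteq> {}\<close>, of "dist u v"]
    by auto
qed

lemma parcs_eccentric_graph_iff:
  "(u, v) \<in> parcs (eccentric_graph G) \<longleftrightarrow>
    u \<in> pverts G \<and> v \<in> pverts G \<and> u \<noteq> v \<and> (eccentric_to G u v \<or> eccentric_to G v u)"
  by (simp add: eccentric_graph_def)

end

section \<open>The two sides of an edge of a tree\<close>

locale simple_tree_graph = connected_pair_graph +
  assumes acyclic: "\<And>p. \<not> simple_cycle G p"
begin

text \<open>This is the component of \<open>a\<close> after deletion of the edge \<open>ab\<close>.
  Walks avoiding both arcs of the edge describe it inside \<open>G\<close>, so no second graph has
  to be built.\<close>

definition side :: "'a \<Rightarrow> 'a \<Rightarrow> 'a set" where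
  "side a b = {x. \<exists>p. awalk a p x \<and> (a, b) \<notin> set p \<and> (b, a) \<notin> set p}"

lemma side_subset: "side a b \<subseteq> pverts G"
  unfolding side_def using awalk_last_in_verts by blast

lemma fst_in_side: "a \<in> pverts G \<Longrightarrow> a \<in> side a b"
  unfolding side_def by (auto intro!: exI[of _ "[]"] simp: awalk_Nil_iff)

text \<open>The one place where \<open>acyclic\<close> is used: a path from \<open>a\<close> to
  \<open>b\<close> avoiding the edge would be closed by the arc \<open>(b, a)\<close> to a
  cycle.\<close>

lemma snd_notin_side:
  assumes ab: "(a, b) \<in> parcs G"
  shows "b \<notin> side a b"
proof
  assume "b \<in> side a b"
  then obtain p where p: "awalk a p b" "(a, b) \<notin> set p" by (auto simp: side_def)
  define q where "q = awalk_to_apath p"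
  have q: "apath a q b" "(a, b) \<notin> set q"
    using apath_awalk_to_apath[OF p(1)] awalk_to_apath_subset[OF p(1)] p(2) by (auto simp: q_def)
  have "a \<noteq> b" using ab no_loops' by blast
  have "q \<noteq> []" using q(1) \<open>a \<noteq> b\<close> by (auto simp: apath_Nil_iff)
  \<comment> \<open>A single arc from \<open>a\<close> to \<open>b\<close> would be
    \<open>(a, b)\<close> itself; hence the closed walk has at least three arcs.\<close>
  moreover have "length q \<noteq> 1"
    using q by (auto simp: length_Suc_conv apath_simps)
  ultimately have "2 \<le> length q" by (cases q; cases "tl q") auto
  moreover have "awalk_verts a q = a # map snd q"
    using awalk_verts_conv'[of a q b] \<open>q \<noteq> []\<close> q(1) pcas_hd_last(1)[of a q b]
    by (auto simp: apath_def awalk_def)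
  moreover have "awalk a (q @ [(b, a)]) a"
    using q(1) arcs_symmetric[OF ab] by (auto intro!: awalk_appendI simp: apath_def awalk_simps dest: wellformed')
  ultimately have "simple_cycle G (q @ [(b, a)])"
    using q(1) unfolding simple_cycle_conv[OF pair_graph] by (auto simp: apath_def awalk_def)
  with acyclic show False by blast
qed

text \<open>A walk witnessing that \<open>x\<close> lies in the side extends along any arc other
  than the two removed ones, and \<open>(b, a)\<close> cannot start in the side.\<close>

lemma arc_leaving_side:
  assumes "(a, b) \<in> parcs G" "(x, y) \<in> parcs G" "x \<in> side a b" "y \<notin> side a b"
  shows "(x, y) = (a, b)"
proof (rule ccontr)
  assume ne: "(x, y) \<noteq> (a, b)"
  obtain p where p: "awalk a p x" "(a, b) \<notin> set p" "(b, a) \<notin> set p"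
    using assms(3) by (auto simp: side_def)
  have "(x, y) \<noteq> (b, a)" using snd_notin_side[OF assms(1)] assms(3) by auto
  moreover have "awalk a (p @ [(x, y)]) y"
    using p(1) assms(2) by (auto intro!: awalk_appendI simp: awalk_simps dest: wellformed')
  ultimately have "y \<in> side a b"
    using ne p unfolding side_def by (auto intro!: exI[of _ "p @ [(x, y)]"])
  with assms(4) show False by simp
qed

lemma awalk_leaving_side:
  assumes "(a, b) \<in> parcs G" "awalk x p y" "x \<in> side a b" "y \<notin> side a b"
  shows "(a, b) \<in> set p"
  using assms(2,3)
proof (induction p arbitrary: x)
  case Nil
  with assms(4) show ?case by (simp add: awalk_Nil_iff)
next
  case (Cons e p)
  then show ?case
    using arc_leaving_side[OF assms(1), of x "snd e"] by (cases e) (auto simp: awalk_Cons_iff)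
qed

lemma awalk_entering_side:
  assumes "(a, b) \<in> parcs G" "awalk x p y" "x \<notin> side a b" "y \<in> side a b"
  shows "(b, a) \<in> set p"
proof -
  have "(a, b) \<in> set (rev_path p)"
    using awalk_leaving_side[OF assms(1), of y "rev_path p" x] assms by simp
  then show ?thesis by (induction p) auto
qed

text \<open>Every walk from \<open>x\<close> to \<open>y\<close> uses the arc \<open>(a, b)\<close>;
  cutting a shortest one there gives the lower bound. The upper bound is the triangle
  inequality.\<close>

lemma graph_dist_across:
  assumes ab: "(a, b) \<in> parcs G" and x: "x \<in> side a b" and y: "y \<in> pverts G" "y \<notin> side a b"
  shows "dist x y = dist x a + 1 + dist b y"
proof (rule antisym)
  have V: "a \<in> pverts G" "b \<in> pverts G" "x \<in> pverts G"
    using ab x side_subset by (auto dest: wellformed')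
  show "dist x y \<le> dist x a + 1 + dist b y"
    using graph_dist_triangle[OF V(3,1) y(1)] graph_dist_triangle[OF V(1,2) y(1)]
      graph_dist_arc[OF ab] by linarith
  obtain p where p: "awalk x p y" "length p = dist x y" using shortest_awalk[OF V(3) y(1)] .
  obtain q r where "p = q @ (a, b) # r"
    using awalk_leaving_side[OF ab p(1) x y(2)] by (auto dest: split_list)
  with p show "dist x a + 1 + dist b y \<le> dist x y"
    using graph_dist_le_length[of x q a] graph_dist_le_length[of b r y] by (auto simp: awalk_Cons_iff)
qed

text \<open>Let \<open>(u, w)\<close> be the first arc of \<open>p\<close>. Its end \<open>v\<close>
  lies beyond this edge, since otherwise the rest of \<open>p\<close> would have to return through
  \<open>u\<close>. Hence \<open>q\<close> crosses \<open>(u, w)\<close> too, and as a path it can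
  do so only at its start.\<close>

lemma apath_unique:
  assumes "apath u p v" "apath u q v"
  shows "p = q"
  using assms
proof (induction p arbitrary: u q)
  case Nil
  then show ?case using apath_nonempty_ends by (auto simp: apath_Nil_iff)
next
  case (Cons e p)
  obtain w where e: "e = (u, w)" using Cons.prems(1) by (cases e) (auto simp: apath_Cons_iff)
  with Cons.prems(1) have uw: "(u, w) \<in> parcs G" and p: "apath w p v" "u \<notin> set (awalk_verts w p)"
    by (auto simp: apath_Cons_iff)
  have "v \<notin> side u w"
  proof
    assume "v \<in> side u w"
    then have "(w, u) \<in> set p"
      using awalk_entering_side[OF uw] p(1) snd_notin_side[OF uw] by (auto simp: apath_def)
    with p show False
      using awalk_verts_arc2[of w p v] by (auto simp: apath_def)
  qed
  moreover have "u \<in> side u w" using fst_in_side uw by (auto dest: wellformed')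
  ultimately have "(u, w) \<in> set q"
    using awalk_leaving_side[OF uw] Cons.prems(2) by (auto simp: apath_def)
  then obtain q1 q2 where q: "q = q1 @ (u, w) # q2" by (auto dest: split_list)
  have "apath u q1 u" "apath w q2 v"
    using Cons.prems(2) unfolding q apath_append_iff by (auto simp: apath_Cons_iff)
  then have "q1 = []" "p = q2" using apath_nonempty_ends Cons.IH[OF p(1)] by blast+
  then show ?case using q e by simp
qed

lemma length_apath_eq_dist: "apath u p v \<Longrightarrow> length p = dist u v"
  using shortest_apath[of u v] apath_unique
  by (metis apath_def awalk_hd_in_verts awalk_last_in_verts)

section \<open>Even diameter\<close>

text \<open>Suppose \<open>x\<close> is farther than \<open>r\<close> from \<open>c\<close>, and let
  \<open>w\<close> be the first step towards \<open>x\<close>. A vertex at distance \<open>r\<close>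
  from \<open>c\<close> on the near side of \<open>cw\<close> would be more than
  \<open>2 * r\<close> from \<open>x\<close>. So \<open>u\<close> and \<open>v\<close> both lie
  beyond \<open>cw\<close> and are one closer to \<open>w\<close> than to \<open>c\<close>, which
  makes \<open>dist u v\<close> too small.\<close>

lemma midpoint_eccentricity:
  assumes V: "u \<in> pverts G" "v \<in> pverts G" "c \<in> pverts G" "x \<in> pverts G"
    and "dist u v = 2 * r" "diam G = 2 * r" "dist u c = r" "dist v c = r"
  shows "dist x c \<le> r"
proof (rule ccontr)
  assume far: "\<not> dist x c \<le> r"
  then obtain n where n: "dist c x = Suc n" "r \<le> n"
    using graph_dist_commute[OF V(3,4)] by (metis less_eq_Suc_le not_le Suc_le_D Suc_le_mono)
  obtain w where w: "(c, w) \<in> parcs G" "dist w x = n"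
    using graph_dist_Suc_arcE[OF V(3,4) n(1)] .
  have W: "w \<in> pverts G" using w(1) by (rule in_arcsD2)
  have "x \<notin> side c w"
  proof
    assume "x \<in> side c w"
    from graph_dist_across[OF w(1) this W snd_notin_side[OF w(1)]] show False
      using n w graph_dist_commute W V graph_dist_self by simp
  qed
  then have same: "y \<notin> side c w" if "y \<in> pverts G" "dist y c = r" for y
    using graph_dist_across[OF w(1) _ V(4)] graph_dist_le_diam[OF that(1) V(4)] assms(6) n w that
    by fastforce
  have closer: "dist y c = 1 + dist w y" if "y \<in> pverts G" "dist y c = r" for y
    using graph_dist_across[OF w(1) fst_in_side[OF V(3)] that(1) same[OF that]]
      graph_dist_self V(3) graph_dist_commute[OF V(3) that(1)] by simp
  have "dist u v \<le> dist w u + dist w v"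
    using graph_dist_triangle[OF V(1) W V(2)] graph_dist_commute[OF V(1) W] by simp
  with closer[of u] closer[of v] assms show False by simp
qed

lemma girth_eccentric_graph_even:
  assumes "even (diam G)" "diam G \<noteq> 0"
  shows "girth (eccentric_graph G) = 3"
proof -
  obtain r where r: "diam G = 2 * r" using assms(1) by blast
  obtain u v where uv: "u \<in> pverts G" "v \<in> pverts G" "dist u v = diam G" using diam_attained .
  obtain c where c: "c \<in> pverts G" "dist u c = r" "dist c v = r"
    using graph_dist_splitE[OF uv(1,2), of r r] uv(3) r by (auto simp: mult_2)
  have vc: "dist v c = r" using c graph_dist_commute uv by simp
  have mid: "dist x c \<le> r" if "x \<in> pverts G" for x
    using midpoint_eccentricity[OF uv(1,2) c(1) that] uv(3) r c(2) vc by simp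
  have ecc: "eccentric_to G u c" "eccentric_to G v c" "eccentric_to G u v"
    using mid uv c vc graph_dist_le_diam by (auto simp: eccentric_to_iff)
  have "r \<noteq> 0" using assms(2) r by simp
  then have "u \<noteq> v" "u \<noteq> c" "v \<noteq> c"
    using uv c vc r graph_dist_self by auto
  with ecc uv c have "(u, v) \<in> parcs (eccentric_graph G)" "(v, c) \<in> parcs (eccentric_graph G)"
    "(c, u) \<in> parcs (eccentric_graph G)"
    by (auto simp: parcs_eccentric_graph_iff)
  with girth_triangle[OF pair_graph_eccentric_graph[OF pair_graph]] show ?thesis by blast
qed

end

section \<open>Odd diameter\<close>

text \<open>No diametrical path is fixed, only its ends and middle edge: the distances already force
  \<open>u\<close> and \<open>v\<close> onto opposite sides of \<open>ab\<close>.\<close>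

locale odd_diam_tree = simple_tree_graph +
  fixes r :: nat and u v a b :: 'a
  assumes diam: "diam G = 2 * r + 1"
    and verts: "u \<in> pverts G" "v \<in> pverts G"
    and ab: "(a, b) \<in> parcs G"
    and dist_uv: "dist u v = 2 * r + 1"
    and dist_ua: "dist u a = r"
    and dist_bv: "dist b v = r"
begin

section \<open>Depths and eccentric vertices around the middle edge\<close>

lemma verts_ab: "a \<in> pverts G" "b \<in> pverts G"
  using ab by (auto dest: wellformed')

text \<open>Otherwise \<open>b\<close> would be closer to \<open>u\<close> than \<open>a\<close> is,
  and going through \<open>b\<close> would give \<open>dist u v\<close> at most
  \<open>2 * r - 1\<close>.\<close>

lemma side_u: "u \<in> side a b"
proof (rule ccontr)
  assume "u \<notin> side a b"
  then have "dist a u = 1 + dist b u"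
    using graph_dist_across[OF ab fst_in_side] verts verts_ab graph_dist_self by simp
  moreover have "dist u v \<le> dist u b + dist b v"
    using graph_dist_triangle verts verts_ab by blast
  ultimately show False
    using dist_uv dist_ua dist_bv graph_dist_commute verts verts_ab by simp
qed

lemma side_v: "v \<notin> side a b"
proof
  assume "v \<in> side a b"
  then have "dist v b = dist v a + 1"
    using graph_dist_across[OF ab _ _ snd_notin_side[OF ab]] verts_ab graph_dist_self by simp
  moreover have "dist u v \<le> dist u a + dist a v"
    using graph_dist_triangle verts verts_ab by blast
  ultimately show False
    using dist_uv dist_ua dist_bv graph_dist_commute verts verts_ab by simp
qed

text \<open>A deeper vertex would be farther from \<open>v\<close>, across the edge, than the
  diameter allows.\<close>

lemma depth_a: "x \<in> side a b \<Longrightarrow> dist x a \<le> r"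
  using graph_dist_across[OF ab _ verts(2) side_v] graph_dist_le_diam[of x v] side_subset verts
    diam dist_bv by fastforce

lemma depth_b: "y \<in> pverts G \<Longrightarrow> y \<notin> side a b \<Longrightarrow> dist b y \<le> r"
  using graph_dist_across[OF ab side_u] graph_dist_le_diam[OF verts(1)] diam dist_ua by fastforce

lemma graph_dist_within_a: "x \<in> side a b \<Longrightarrow> y \<in> side a b \<Longrightarrow> dist x y \<le> dist x a + r"
  using graph_dist_triangle[of x a y] depth_a[of y] side_subset verts_ab graph_dist_commute[of a y]
  by fastforce

lemma graph_dist_within_b:
  assumes "x \<in> pverts G" "x \<notin> side a b" "y \<in> pverts G" "y \<notin> side a b"
  shows "dist x y \<le> r + dist b y"
  using graph_dist_triangle[of x b y] depth_b[of x] assms verts_ab graph_dist_commute[of b x]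
  by fastforce

text \<open>The eccentricity of \<open>x\<close> is \<open>dist x a + 1 + r\<close>: it is attained
  at \<open>v\<close>, and vertices on the side of \<open>x\<close> fall short of it by at least 1.
  Across the edge it is attained exactly at depth \<open>r\<close>.\<close>

lemma eccentric_to_a_iff:
  assumes x: "x \<in> side a b" and y: "y \<in> pverts G"
  shows "eccentric_to G y x \<longleftrightarrow> y \<notin> side a b \<and> dist b y = r"
proof -
  have xV: "x \<in> pverts G" using x side_subset by blast
  have comm: "dist w x = dist x w" if "w \<in> pverts G" for w using graph_dist_commute that xV by blast
  have far: "dist x v = dist x a + 1 + r"
    using graph_dist_across[OF ab x verts(2) side_v] dist_bv by simp
  have bound: "dist x w \<le> dist x a + 1 + r" if "w \<in> pverts G" for w
    using graph_dist_within_a[OF x, of w] graph_dist_across[OF ab x that] depth_b[OF that] by fastforce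
  have "eccentric_to G y x \<longleftrightarrow> dist x y = dist x a + 1 + r"
    unfolding eccentric_to_iff[OF y] using bound far comm verts(2) y by (metis le_antisym order_refl)
  also have "\<dots> \<longleftrightarrow> y \<notin> side a b \<and> dist b y = r"
    using graph_dist_within_a[OF x, of y] graph_dist_across[OF ab x y] by fastforce
  finally show ?thesis .
qed

lemma eccentric_to_b_iff:
  assumes y: "y \<in> pverts G" "y \<notin> side a b" and x: "x \<in> pverts G"
  shows "eccentric_to G x y \<longleftrightarrow> x \<in> side a b \<and> dist x a = r"
proof -
  have far: "dist u y = r + 1 + dist b y"
    using graph_dist_across[OF ab side_u y] dist_ua by simp
  have bound: "dist w y \<le> r + 1 + dist b y" if "w \<in> pverts G" for w
    using graph_dist_within_b[OF that _ y] graph_dist_across[OF ab _ y, of w] depth_a[of w] by fastforce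
  have "eccentric_to G x y \<longleftrightarrow> dist x y = r + 1 + dist b y"
    unfolding eccentric_to_iff[OF x] using bound far verts(1) x by (metis le_antisym order_refl)
  also have "\<dots> \<longleftrightarrow> x \<in> side a b \<and> dist x a = r"
    using graph_dist_within_b[OF x _ y] graph_dist_across[OF ab _ y, of x] by fastforce
  finally show ?thesis .
qed

lemma eccentric_graph_sides:
  assumes "(x, y) \<in> parcs (eccentric_graph G)"
  shows "x \<in> side a b \<longleftrightarrow> y \<notin> side a b"
  using assms eccentric_to_a_iff eccentric_to_b_iff unfolding parcs_eccentric_graph_iff by blast

lemma eccentric_graph_across_iff:
  assumes "x \<in> side a b" "y \<in> pverts G" "y \<notin> side a b"
  shows "(x, y) \<in> parcs (eccentric_graph G) \<longleftrightarrow> dist x a = r \<or> dist b y = r"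
    and "(y, x) \<in> parcs (eccentric_graph G) \<longleftrightarrow> dist x a = r \<or> dist b y = r"
  using assms eccentric_to_a_iff[OF assms(1,2)] eccentric_to_b_iff[OF assms(2,3)] side_subset
  unfolding parcs_eccentric_graph_iff by blast+

section \<open>Extremal vertices and uniqueness of the diametrical path\<close>

definition unique_extremal :: bool where
  "unique_extremal \<longleftrightarrow> (\<forall>x\<in>side a b. dist x a = r \<longrightarrow> x = u) \<and>
    (\<forall>y\<in>pverts G - side a b. dist b y = r \<longrightarrow> y = v)"

text \<open>Distance \<open>2 * r + 1\<close> occurs exactly between extremal vertices on opposite
  sides, and \<open>apath_unique\<close> leaves one path for each such pair of ends.\<close>

lemma unique_extremal_iff: "unique_extremal \<longleftrightarrow> unique_diametrical_path G"
proof
  assume ext: unique_extremal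
  obtain p where p: "apath u p v" "length p = dist u v" using shortest_apath[OF verts] .
  have ends: "x = u \<and> y = v"
    if "x \<in> side a b" "y \<in> pverts G" "y \<notin> side a b" "dist x y = 2 * r + 1" for x y
    using graph_dist_across[OF ab that(1-3)] depth_a[OF that(1)] depth_b[OF that(2,3)] that ext
    by (auto simp: unique_extremal_def)
  have "q = p \<or> q = rev_path p" if diam_path: "diametrical_path G q" for q
  proof -
    obtain x y where q: "apath x q y" "length q = 2 * r + 1"
      using diam_path diam by (auto simp: diametrical_path_def)
    have xy: "x \<in> pverts G" "y \<in> pverts G"
      using q(1) awalk_hd_in_verts awalk_last_in_verts by (auto simp: apath_def)
    have d: "dist x y = 2 * r + 1" using length_apath_eq_dist[OF q(1)] q(2) by simp
    \<comment> \<open>Two vertices on the same side are at distance at most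
      \<open>2 * r\<close>.\<close>
    consider "x \<in> side a b" "y \<notin> side a b" | "x \<notin> side a b" "y \<in> side a b"
      using graph_dist_within_a[of x y] graph_dist_within_b[of x y] depth_a[of x] depth_b[of y] d xy
      by fastforce
    then show ?thesis
    proof cases
      case 1
      with ends[OF 1(1) xy(2) 1(2) d] q(1) p(1) apath_unique show ?thesis by blast
    next
      case 2
      have "y = u \<and> x = v" using ends[OF 2(2) xy(1) 2(1)] d graph_dist_commute[OF xy] by simp
      then have "rev_path q = p" using q(1) p(1) apath_unique by simp
      then show ?thesis by auto
    qed
  qed
  moreover have "diametrical_path G p"
    using p dist_uv diam by (auto simp: diametrical_path_def)
  ultimately show "unique_diametrical_path G"
    by (auto simp: unique_diametrical_path_def)
next
  assume "unique_diametrical_path G"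
  then obtain p where p: "\<And>q. diametrical_path G q \<Longrightarrow> q = p \<or> q = rev_path p"
    by (auto simp: unique_diametrical_path_def)
  have ends: "x = u \<and> y = v"
    if "x \<in> side a b" "y \<in> pverts G" "y \<notin> side a b" "dist x a = r" "dist b y = r" for x y
  proof -
    note xy = that
    have xV: "x \<in> pverts G" using that(1) side_subset by blast
    have d: "dist x y = 2 * r + 1" using graph_dist_across[OF ab that(1-3)] that by simp
    obtain q where q: "apath x q y" "length q = dist x y" using shortest_apath[OF xV xy(2)] .
    obtain q' where q': "apath u q' v" "length q' = dist u v" using shortest_apath[OF verts] .
    have "diametrical_path G q" "diametrical_path G q'"
      using q q' d dist_uv diam by (auto simp: diametrical_path_def)
    with p have "q = q' \<or> q = rev_path q'" by (metis rev_path_rev_path)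
    moreover have "q \<noteq> []" using q(2) d by auto
    \<comment> \<open>Both paths start on the side of \<open>a\<close>, so neither is the reversal
      of the other.\<close>
    moreover have "q \<noteq> rev_path q'"
    proof
      assume "q = rev_path q'"
      with q' have "apath v q u" by simp
      with apath_ends[OF q(1) this] \<open>q \<noteq> []\<close> have "x = v" by simp
      with that(1) side_v show False by simp
    qed
    ultimately show ?thesis using apath_ends[OF q(1), of u v] q'(1) by auto
  qed
  \<comment> \<open>One end is varied at a time, the other staying at \<open>v\<close> or
    \<open>u\<close>.\<close>
  show unique_extremal
    unfolding unique_extremal_def
    using ends[OF _ verts(2) side_v _ dist_bv] ends[OF side_u _ _ dist_ua] by blast
qed

lemma girth_eccentric_graph:
  "girth (eccentric_graph G) = (if unique_diametrical_path G then 0 else 4)"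
proof (cases unique_extremal)
  case True
  \<comment> \<open>A vertex other than the centres \<open>u\<close> and \<open>v\<close> is not
    extremal, so its only neighbour is the centre on the opposite side.\<close>
  have "y = z" if x: "x \<noteq> u" "x \<noteq> v" and adj: "(x, y) \<in> parcs (eccentric_graph G)"
    "(x, z) \<in> parcs (eccentric_graph G)" for x y z
  proof -
    have V: "x \<in> pverts G" "y \<in> pverts G" "z \<in> pverts G"
      using adj by (auto simp: parcs_eccentric_graph_iff)
    show ?thesis
    proof (cases "x \<in> side a b")
      case xA: True
      then have "w = v" if "(x, w) \<in> parcs (eccentric_graph G)" "w \<in> pverts G" for w
        using eccentric_graph_sides[OF that(1)] eccentric_graph_across_iff(1)[OF xA that(2)] that True x
        unfolding unique_extremal_def by blast
      with adj V show ?thesis by blast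
    next
      case xB: False
      then have "w = u" if "(x, w) \<in> parcs (eccentric_graph G)" "w \<in> pverts G" for w
        using eccentric_graph_sides[OF that(1)] eccentric_graph_across_iff(2)[OF _ V(1) xB, of w] that True x V
        unfolding unique_extremal_def by blast
      with adj V show ?thesis by blast
    qed
  qed
  from girth_double_star[OF pair_graph_eccentric_graph[OF pair_graph] this] True
  show ?thesis by (simp add: unique_extremal_iff)
next
  case False
  let ?E = "parcs (eccentric_graph G)"
  note adj = eccentric_graph_across_iff
  have a: "a \<in> side a b" using fst_in_side verts_ab by blast
  have b: "b \<notin> side a b" using snd_notin_side[OF ab] .
  have no_triangle: "(z, x) \<notin> ?E" if "(x, y) \<in> ?E" "(y, z) \<in> ?E" for x y z
    using that eccentric_graph_sides by blast
  have sq: "girth (eccentric_graph G) = 4"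
    if "(x, y) \<in> ?E" "(y, z) \<in> ?E" "(z, w) \<in> ?E" "(w, x) \<in> ?E" "x \<noteq> z" "y \<noteq> w" for x y z w
    using girth_square[OF pair_graph_eccentric_graph[OF pair_graph] that no_triangle] .
  \<comment> \<open>For \<open>r = 0\<close> only \<open>a\<close> and \<open>b\<close> could be
    extremal. A positive \<open>r\<close> separates \<open>a\<close> from \<open>u\<close> and
    \<open>b\<close> from \<open>v\<close>, as the squares below require.\<close>
  have "r \<noteq> 0"
  proof
    assume "r = 0"
    then have "x = a" if "x \<in> side a b" "dist x a = r" for x
      using graph_dist_eq_0D that verts_ab side_subset by blast
    moreover have "y = b" if "y \<in> pverts G" "dist b y = r" for y
      using graph_dist_eq_0D that verts_ab \<open>r = 0\<close> by metis
    ultimately show False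
      using False verts side_u dist_ua dist_bv unfolding unique_extremal_def by blast
  qed
  then have "a \<noteq> u" "b \<noteq> v" using dist_ua dist_bv graph_dist_self verts_ab by auto
  from False consider x where "x \<in> side a b" "dist x a = r" "x \<noteq> u"
    | y where "y \<in> pverts G" "y \<notin> side a b" "dist b y = r" "y \<noteq> v"
    unfolding unique_extremal_def by blast
  then have "girth (eccentric_graph G) = 4"
  proof cases
    \<comment> \<open>In the square \<open>x\<close>, \<open>b\<close>, \<open>u\<close>,
      \<open>v\<close> every edge contains \<open>x\<close> or \<open>u\<close>, both extremal. The
      other case is the mirror image, with \<open>y\<close> and \<open>v\<close> extremal.\<close>
    case 1
    show ?thesis
      using adj[OF 1(1) verts_ab(2) b] adj[OF side_u verts_ab(2) b] adj[OF side_u verts(2) side_v]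
        adj[OF 1(1) verts(2) side_v] 1 \<open>b \<noteq> v\<close> dist_ua dist_bv
      by (intro sq[of x b u v]) auto
  next
    case 2
    show ?thesis
      using adj[OF a 2(1,2)] adj[OF side_u 2(1,2)] adj[OF side_u verts(2) side_v]
        adj[OF a verts(2) side_v] 2 \<open>a \<noteq> u\<close> dist_ua dist_bv
      by (intro sq[of y a v u]) auto
  qed
  with False show ?thesis by (simp add: unique_extremal_iff)
qed

end

section \<open>Choice of the middle edge and conclusion\<close>

context simple_tree_graph
begin

lemma girth_eccentric_graph_odd:
  assumes "odd (diam G)"
  shows "girth (eccentric_graph G) = (if unique_diametrical_path G then 0 else 4)"
proof -
  obtain r where r: "diam G = 2 * r + 1" using assms by (rule oddE)
  obtain u v where uv: "u \<in> pverts G" "v \<in> pverts G" "dist u v = diam G" using diam_attained .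
  obtain a where a: "a \<in> pverts G" "dist u a = r" "dist a v = Suc r"
    using graph_dist_splitE[OF uv(1,2), of r "Suc r"] uv(3) r by auto
  obtain b where "(a, b) \<in> parcs G" "dist b v = r"
    using graph_dist_Suc_arcE[OF a(1) uv(2) a(3)] .
  with r uv a interpret odd_diam_tree G r u v a b
    by unfold_locales auto
  show ?thesis by (rule girth_eccentric_graph)
qed

end

theorem theorem3:
  fixes T :: "'a pair_pre_digraph"
  assumes "simple_tree T"
    and "card (pverts T) \<ge> 2"
  shows "girth (eccentric_graph T) \<in> {0, 3, 4} \<and>
    (even (diam T) \<longrightarrow> girth (eccentric_graph T) = 3) \<and>
    (odd (diam T) \<and> unique_diametrical_path T \<longrightarrow> girth (eccentric_graph T) = 0) \<and>
    (odd (diam T) \<and> \<not> unique_diametrical_path T \<longrightarrow> girth (eccentric_graph T) = 4)"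
proof -
  interpret pair_graph T using assms(1) by (simp add: simple_tree_def)
  interpret simple_tree_graph T
    using assms(1) by unfold_locales (auto simp: simple_tree_def)
  \<comment> \<open>Zero is even, but the triangle for even diameter needs a positive radius; two
    vertices guarantee it.\<close>
  have "diam T \<noteq> 0"
  proof
    assume "diam T = 0"
    then have "x = y" if "x \<in> pverts T" "y \<in> pverts T" for x y
      using graph_dist_le_diam[OF that] graph_dist_eq_0D[OF that] by simp
    then have "card (pverts T) \<le> 1" using card_le_Suc0_iff_eq[OF pair_finite_verts] by simp
    with assms(2) show False by simp
  qed
  then show ?thesis
    using girth_eccentric_graph_even girth_eccentric_graph_odd by (cases "even (diam T)") auto
qed

end
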